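(* Let $\Pi$ be a ground program with set of atoms $\mathcal{A}$, and let $A \subseteq \mathcal{A}$. For every answer set $I \in AS(\Pi)$ it holds that $I|_{\overline{A}} \in AS(\mathit{omit}(\Pi,A))$.
   Context: A ground program $\Pi$ is a finite set of rules $r$ of the form $\alpha_0 \leftarrow \alpha_1,\dots,\alpha_m, \mathit{not}\ \alpha_{m+1},\dots,\mathit{not}\ \alpha_n$ ($0\le m\le n$), where $\alpha_1,\dots,\alpha_n$ are propositional atoms and $\alpha_0$ is an atom or $\bot$ (then $r$ is a constraint); programs may also contain choice rules $\{\alpha\}\leftarrow B$. Write $H(r)=\alpha_0$, $B^+(r)=\{\alpha_1,\dots,\alpha_m\}$, $B^-(r)=\{\alpha_{m+1},\dots,\alpha_n\}$, $B^\pm(r)=B^+(r)\cup B^-(r)$, and $B(r)$ for the body. $\mathcal{A}$ is the set of atoms of $\Pi$. An interpretation $I$ (a set of atoms) satisfies $B(r)$ if $B^+(r)\subseteq I$ and $B^-(r)\cap I=\emptyset$. $I$ is an answer set of $\Pi$ iff $I$ is a $\subseteq$-minimal model of $\{r\in\Pi \mid I\models B(r)\}$; $AS(\Pi)$ denotes the set of answer sets. A choice rule $\{\alpha\}\leftarrow B$ abbreviates the rules $\alpha\leftarrow B,\mathit{not}\ \bar\alpha$ and $\bar\alpha \leftarrow B, \mathit{not}\ \alpha$ with a fresh auxiliary atom $\bar\alpha$; answer sets are considered with these auxiliary atoms projected away. For $A\subseteq\mathcal{A}$ and a rule $r$, $\mathit{omit}(r,A)$ is: (a) $r$ itself if $A\cap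 B^\pm(r)=\emptyset$ and $H(r)\notin A$; (b) the choice rule $\{H(r)\}\leftarrow B^+(r)\setminus A, \mathit{not}\ (B^-(r)\setminus A)$ if $A\cap B^\pm(r)\neq\emptyset$ and $H(r)\notin A\cup\{\bot\}$; (c) no rule otherwise. For a choice rule $\{\alpha\}\leftarrow B$, it is kept if no body atom is in $A$ and $\alpha\notin A$, becomes $\{\alpha\}\leftarrow B\setminus A$ (omitted atoms and their literals removed from the body) if some body atom is in $A$ and $\alpha\notin A$, and is dropped otherwise. $\mathit{omit}(\Pi,A)=\bigcup_{r\in\Pi}\mathit{omit}(r,A)$. Let $\overline{A}=\mathcal{A}\setminus A$ and $I|_{\overline{A}}=I\cap\overline{A}$. *)

theory Defs imports Main begin

text \<open>The head \<open>None\<close> stands for falsity: such a rule is a constraint.\<close>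

datatype 'a rule =
  Rule (head: "'a option") (pos_body: "'a set") (neg_body: "'a set")

definition body_sat :: "'a set \<Rightarrow> 'a rule \<Rightarrow> bool" where
  "body_sat I r \<longleftrightarrow> pos_body r \<subseteq> I \<and> neg_body r \<inter> I = {}"

definition rule_sat :: "'a set \<Rightarrow> 'a rule \<Rightarrow> bool" where
  "rule_sat I r \<longleftrightarrow> (body_sat I r \<longrightarrow> (\<exists>a\<in>I. head r = Some a))"

definition is_model :: "'a set \<Rightarrow> 'a rule set \<Rightarrow> bool" where
  "is_model I P \<longleftrightarrow> (\<forall>r\<in>P. rule_sat I r)"

definition reduct :: "'a rule set \<Rightarrow> 'a set \<Rightarrow> 'a rule set" where
  "reduct P I = {r \<in> P. body_sat I r}"

definition is_answer_set :: "'a set \<Rightarrow> 'a rule set \<Rightarrow> bool" where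
  "is_answer_set I P \<longleftrightarrow>
     is_model I (reduct P I) \<and> (\<forall>J. J \<subset> I \<longrightarrow> \<not> is_model J (reduct P I))"

datatype 'a prule =
    Plain "'a rule"
  | Choice 'a "'a set" "'a set"

type_synonym 'a program = "'a prule set"

fun prule_body :: "'a prule \<Rightarrow> 'a set" where
  "prule_body (Plain r) = pos_body r \<union> neg_body r"
| "prule_body (Choice a Bp Bn) = Bp \<union> Bn"

fun prule_head :: "'a prule \<Rightarrow> 'a option" where
  "prule_head (Plain r) = head r"
| "prule_head (Choice a Bp Bn) = Some a"

definition ground_program :: "'a program \<Rightarrow> bool" where
  "ground_program P \<longleftrightarrow> finite P \<and> (\<forall>r\<in>P. finite (prule_body r))"

definition atoms :: "'a program \<Rightarrow> 'a set" where
  "atoms P = (\<Union>r\<in>P. set_option (prule_head r) \<union> prule_body r)"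

text \<open>
  Choice rules are eliminated over an extended set of atoms: \<open>Aux a\<close> is the auxiliary
  atom associated with \<open>a\<close>. It is fresh because program atoms become \<open>Orig\<close> atoms.
\<close>

datatype 'a ext = Orig 'a | Aux 'a

fun expand_rule :: "'a prule \<Rightarrow> 'a ext rule set" where
  "expand_rule (Plain r) =
     {Rule (map_option Orig (head r)) (Orig ` pos_body r) (Orig ` neg_body r)}"
| "expand_rule (Choice a Bp Bn) =
     {Rule (Some (Orig a)) (Orig ` Bp) (insert (Aux a) (Orig ` Bn)),
      Rule (Some (Aux a)) (Orig ` Bp) (insert (Orig a) (Orig ` Bn))}"

definition expand :: "'a program \<Rightarrow> 'a ext rule set" where
  "expand P = (\<Union>r\<in>P. expand_rule r)"

definition AS :: "'a program \<Rightarrow> 'a set set" where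
  "AS P = {{a. Orig a \<in> J} | J. is_answer_set J (expand P)}"

fun omit_rule :: "'a prule \<Rightarrow> 'a set \<Rightarrow> 'a prule set" where
  "omit_rule (Plain r) A =
     (if A \<inter> (pos_body r \<union> neg_body r) = {} \<and> head r \<notin> Some ` A then {Plain r}
      else (case head r of
          None \<Rightarrow> {}
        | Some a \<Rightarrow>
            (if A \<inter> (pos_body r \<union> neg_body r) \<noteq> {} \<and> a \<notin> A
             then {Choice a (pos_body r - A) (neg_body r - A)} else {})))"
| "omit_rule (Choice a Bp Bn) A =
     (if a \<in> A then {}
      else if A \<inter> (Bp \<union> Bn) = {} then {Choice a Bp Bn}
      else {Choice a (Bp - A) (Bn - A)})"

definition omit :: "'a program \<Rightarrow> 'a set \<Rightarrow> 'a program" where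
  "omit P A = (\<Union>r\<in>P. omit_rule r A)"

end

theory Submission imports Defs begin

text \<open>
  Let \<open>J\<close> be an answer set of the expanded program. Discard the omitted atoms from \<open>J\<close> and let
  \<open>Aux a\<close> hold exactly when \<open>a\<close> is false and some choice rule for \<open>a\<close> in the omission has a true
  body. The result \<open>J'\<close> is a model of its reduct. A smaller model \<open>K\<close> must drop a set \<open>M\<close> of
  original atoms of \<open>J'\<close>, since the auxiliary atoms are forced by the original ones; but then
  \<open>J - M\<close> is a model of the reduct of the original program, because every rule deriving an atom
  of \<open>M\<close> survives, possibly weakened to a choice rule, in the omission. This contradicts the
  minimality of \<open>J\<close>.
\<close>

text \<open>Since \<open>K\<close> lies below \<open>J\<close>, a positive body true in
  \<open>K\<close> is true in \<open>J\<close>, and a negative body avoiding \<open>J\<close> avoids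
  \<open>K\<close>. Hence positive bodies are tested only in \<open>K\<close> and negative bodies
  only in \<open>J\<close>, as in the Gelfond-Lifschitz reduct.\<close>

lemma is_model_reduct_expand_iff:
  assumes "K \<subseteq> J"
  shows "is_model K (reduct (expand P) J) \<longleftrightarrow>
    (\<forall>r. Plain r \<in> P \<longrightarrow> Orig ` pos_body r \<subseteq> K \<longrightarrow> Orig ` neg_body r \<inter> J = {} \<longrightarrow>
        (\<exists>a. head r = Some a \<and> Orig a \<in> K)) \<and>
    (\<forall>a Bp Bn. Choice a Bp Bn \<in> P \<longrightarrow> Orig ` Bp \<subseteq> K \<longrightarrow> Orig ` Bn \<inter> J = {} \<longrightarrow>
        (Aux a \<notin> J \<longrightarrow> Orig a \<in> K) \<and> (Orig a \<notin> J \<longrightarrow> Aux a \<in> K))"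
    (is "?M \<longleftrightarrow> ?R")
proof -
  define Q :: "'a prule \<Rightarrow> bool" where
    "Q p \<longleftrightarrow> (\<forall>r\<in>expand_rule p. pos_body r \<subseteq> K \<longrightarrow> neg_body r \<inter> J = {} \<longrightarrow>
      (\<exists>a\<in>K. head r = Some a))" for p
  have "?M \<longleftrightarrow> (\<forall>p\<in>P. Q p)"
    unfolding is_model_def reduct_def expand_def rule_sat_def body_sat_def Q_def
    using assms by blast
  moreover have "(\<forall>p\<in>P. Q p) \<longleftrightarrow> (\<forall>r. Plain r \<in> P \<longrightarrow> Q (Plain r)) \<and>
      (\<forall>a Bp Bn. Choice a Bp Bn \<in> P \<longrightarrow> Q (Choice a Bp Bn))"
    by (metis prule.exhaust)
  moreover have "Q (Plain r) \<longleftrightarrow> (Orig ` pos_body r \<subseteq> K \<longrightarrow> Orig ` neg_body r \<inter> J = {} \<longrightarrow>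
      (\<exists>a. head r = Some a \<and> Orig a \<in> K))" for r
    by (cases "head r") (simp_all add: Q_def)
  moreover have "Q (Choice a Bp Bn) \<longleftrightarrow> (Orig ` Bp \<subseteq> K \<longrightarrow> Orig ` Bn \<inter> J = {} \<longrightarrow>
      (Aux a \<notin> J \<longrightarrow> Orig a \<in> K) \<and> (Orig a \<notin> J \<longrightarrow> Aux a \<in> K))" for a Bp Bn
    by (cases "Aux a \<in> J"; cases "Orig a \<in> J") (auto simp: Q_def)
  ultimately show ?thesis by simp
qed

lemma Plain_in_omitD:
  assumes "Plain r \<in> omit P A"
  shows "Plain r \<in> P" "A \<inter> (pos_body r \<union> neg_body r) = {}" "head r \<notin> Some ` A"
proof -
  obtain p where p: "p \<in> P" "Plain r \<in> omit_rule p A"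
    using assms by (auto simp: omit_def)
  have "p = Plain r \<and> A \<inter> (pos_body r \<union> neg_body r) = {} \<and> head r \<notin> Some ` A"
    using p(2) by (cases p) (simp_all split: if_splits option.splits)
  with p(1) show "Plain r \<in> P" "A \<inter> (pos_body r \<union> neg_body r) = {}" "head r \<notin> Some ` A"
    by simp_all
qed

lemma omit_Plain:
  assumes "Plain r \<in> P" "head r = Some a" "a \<notin> A"
  shows "Plain r \<in> omit P A \<or> Choice a (pos_body r - A) (neg_body r - A) \<in> omit P A"
proof (cases "A \<inter> (pos_body r \<union> neg_body r) = {}")
  case True
  with assms have "Plain r \<in> omit_rule (Plain r) A" by auto
  with assms(1) show ?thesis unfolding omit_def by blast
next
  case False
  with assms have "Choice a (pos_body r - A) (neg_body r - A) \<in> omit_rule (Plain r) A" by auto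
  with assms(1) show ?thesis unfolding omit_def by blast
qed

text \<open>Kept and weakened choice rules share one form, because removing \<open>A\<close> from a
  body disjoint from \<open>A\<close> changes nothing.\<close>

lemma omit_Choice:
  assumes "Choice a Bp Bn \<in> P" "a \<notin> A"
  shows "Choice a (Bp - A) (Bn - A) \<in> omit P A"
proof -
  have "A \<inter> (Bp \<union> Bn) = {} \<Longrightarrow> Bp - A = Bp \<and> Bn - A = Bn" by blast
  with assms(2) have "Choice a (Bp - A) (Bn - A) \<in> omit_rule (Choice a Bp Bn) A" by auto
  with assms(1) show ?thesis unfolding omit_def by blast
qed

lemma atoms_Plain:
  assumes "Plain r \<in> P"
  shows "pos_body r \<subseteq> atoms P" "neg_body r \<subseteq> atoms P" "head r = Some a \<Longrightarrow> a \<in> atoms P"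
  using assms by (force simp: atoms_def)+

lemma atoms_Choice:
  assumes "Choice a Bp Bn \<in> P"
  shows "Bp \<subseteq> atoms P"
  using assms by (force simp: atoms_def)

theorem theorem1:
  fixes P :: "'a program" and A I :: "'a set"
  assumes "ground_program P"
    and "A \<subseteq> atoms P"
    and "I \<in> AS P"
  shows "I \<inter> (atoms P - A) \<in> AS (omit P A)"
proof -
  obtain J where I: "I = {a. Orig a \<in> J}" and J: "is_answer_set J (expand P)"
    using assms(3) by (auto simp: AS_def)
  define I' where "I' = I \<inter> (atoms P - A)"
  \<comment> \<open>For \<open>a\<close> in \<open>I'\<close>, the falsity of \<open>Aux a\<close>
    keeps the rules deriving \<open>a\<close> from active choices in the reduct, so that they
    support \<open>a\<close>. For \<open>a\<close> outside \<open>I'\<close>, \<open>Aux a\<close>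
    blocks these rules and satisfies their duals.\<close>
  define J' where "J' = Orig ` I' \<union>
    {Aux a | a. a \<notin> I' \<and> (\<exists>Bp Bn. Choice a Bp Bn \<in> omit P A \<and> Bp \<subseteq> I' \<and> Bn \<inter> I' = {})}"
  have Orig_J': "Orig a \<in> J' \<longleftrightarrow> a \<in> I'" for a by (auto simp: J'_def)
  have Aux_J': "Aux a \<in> J' \<longleftrightarrow>
      a \<notin> I' \<and> (\<exists>Bp Bn. Choice a Bp Bn \<in> omit P A \<and> Bp \<subseteq> I' \<and> Bn \<inter> I' = {})" for a
    by (auto simp: J'_def)
  have Orig_sub: "Orig ` B \<subseteq> J' \<longleftrightarrow> B \<subseteq> I'" for B by (auto simp: Orig_J')
  have Orig_disj: "Orig ` B \<inter> J' = {} \<longleftrightarrow> B \<inter> I' = {}" for B using Orig_J' by blast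
  have min: "\<not> is_model K (reduct (expand P) J)" if "K \<subset> J" for K
    using J that by (simp add: is_answer_set_def)
  have "is_model J (reduct (expand P) J)"
    using J by (simp add: is_answer_set_def)
  note J_model = this[unfolded is_model_reduct_expand_iff[OF order_refl]]
  have J_Plain: "\<exists>a. head r = Some a \<and> Orig a \<in> J"
    if "Plain r \<in> P" "Orig ` pos_body r \<subseteq> J" "Orig ` neg_body r \<inter> J = {}" for r
    using J_model[THEN conjunct1] that by blast
  have J_Choice: "(Aux a \<notin> J \<longrightarrow> Orig a \<in> J) \<and> (Orig a \<notin> J \<longrightarrow> Aux a \<in> J)"
    if "Choice a Bp Bn \<in> P" "Orig ` Bp \<subseteq> J" "Orig ` Bn \<inter> J = {}" for a Bp Bn
    using J_model[THEN conjunct2, rule_format, OF that] by blast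
  have "is_model J' (reduct (expand (omit P A)) J')"
    unfolding is_model_reduct_expand_iff[OF order_refl] Orig_sub Orig_disj Orig_J'
  proof (intro conjI allI impI)
    fix r assume r: "Plain r \<in> omit P A" "pos_body r \<subseteq> I'" "neg_body r \<inter> I' = {}"
    note P = Plain_in_omitD(1)[OF r(1)] and disj = Plain_in_omitD(2)[OF r(1)]
      and hd = Plain_in_omitD(3)[OF r(1)]
    \<comment> \<open>All body atoms of a kept rule lie in \<open>atoms P - A\<close>, where
      \<open>I\<close> and \<open>I'\<close> agree.\<close>
    have "Orig ` neg_body r \<inter> J = {}"
      using r(3) disj atoms_Plain(2)[OF P] by (auto simp: I'_def I)
    moreover have "Orig ` pos_body r \<subseteq> J" using r(2) by (auto simp: I'_def I)
    ultimately show "\<exists>a. head r = Some a \<and> a \<in> I'"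
      using J_Plain[OF P] hd atoms_Plain(3)[OF P] by (auto simp: I'_def I)
  qed (auto simp: Aux_J')
  moreover have False if K: "K \<subset> J'" and model: "is_model K (reduct (expand (omit P A)) J')" for K
  proof -
    note K_model =
      model[unfolded is_model_reduct_expand_iff[OF psubset_imp_subset[OF K]] Orig_disj]
    have K_Plain: "Orig a \<in> K"
      if "Plain r \<in> omit P A" "head r = Some a" "Orig ` pos_body r \<subseteq> K" "neg_body r \<inter> I' = {}"
      for r a
      using K_model[THEN conjunct1, rule_format, OF that(1,3,4)] that(2) by simp
    have K_Choice: "(Aux a \<notin> J' \<longrightarrow> Orig a \<in> K) \<and> (Orig a \<notin> J' \<longrightarrow> Aux a \<in> K)"
      if "Choice a Bp Bn \<in> omit P A" "Orig ` Bp \<subseteq> K" "Bn \<inter> I' = {}" for a Bp Bn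
      using K_model[THEN conjunct2, rule_format, OF that] by blast
    define M where "M = Orig ` I' - K"
    have "M \<noteq> {}"
    proof
      assume "M = {}"
      then have sub: "Orig ` I' \<subseteq> K" by (auto simp: M_def)
      \<comment> \<open>The choice body that justifies \<open>Aux a\<close> in \<open>J'\<close> is
        also true in \<open>K\<close>, and \<open>a\<close> is false in \<open>J'\<close>, so
        \<open>K\<close> has to contain \<open>Aux a\<close>.\<close>
      have "Aux a \<in> K" if "Aux a \<in> J'" for a
        using that K_Choice sub unfolding Aux_J' Orig_J' by (meson image_mono order_trans)
      moreover have "Orig a \<in> K" if "Orig a \<in> J'" for a
        using that sub by (auto simp: Orig_J')
      ultimately have "J' \<subseteq> K" by (metis ext.exhaust subsetI)
      with K show False by blast
    qed
    moreover have "M \<subseteq> J" by (auto simp: M_def I'_def I)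
    ultimately have less: "J - M \<subset> J" by blast
    \<comment> \<open>An atom of \<open>J\<close> over \<open>atoms P - A\<close> belongs to
      \<open>I'\<close>, so it is missing from \<open>K\<close> only if it lies in
      \<open>M\<close>.\<close>
    have KI: "Orig ` (B - A) \<subseteq> K" if "Orig ` B \<subseteq> J - M" "B \<subseteq> atoms P" for B
      using that by (auto simp: M_def I'_def I)
    \<comment> \<open>\<open>C\<close> is \<open>A\<close> for weakened bodies and \<open>{}\<close>
      for rules kept whole.\<close>
    have NI: "(B - C) \<inter> I' = {}" if "Orig ` B \<inter> J = {}" for B C
      using that by (auto simp: I'_def I)
    \<comment> \<open>An atom of \<open>M\<close> is true in \<open>J'\<close>, so its auxiliary
      atom is false there. The choice is then not free: its body is true in \<open>K\<close> and
      forces the atom into \<open>K\<close>, which \<open>M\<close> excludes.\<close>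
    have no_choice: False
      if "Orig a \<in> M" "Choice a (Bp - A) (Bn - A) \<in> omit P A"
        "Orig ` Bp \<subseteq> J - M" "Orig ` Bn \<inter> J = {}" "Bp \<subseteq> atoms P" for a Bp Bn
    proof -
      have "Aux a \<notin> J'" using that(1) by (auto simp: M_def Aux_J')
      with K_Choice[OF that(2) KI[OF that(3,5)] NI[OF that(4)]] that(1) show False
        by (auto simp: M_def)
    qed
    have M_notin_A: "a \<notin> A" if "Orig a \<in> M" for a using that by (auto simp: M_def I'_def)
    have Plain_M: "Orig a \<notin> M"
      if r: "Plain r \<in> P" "Orig ` pos_body r \<subseteq> J - M" "Orig ` neg_body r \<inter> J = {}"
        and hd: "head r = Some a" for r a
    proof
      assume a: "Orig a \<in> M"
      from omit_Plain[OF r(1) hd M_notin_A[OF a]] show False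
      proof
        assume om: "Plain r \<in> omit P A"
        have "pos_body r - A = pos_body r" using Plain_in_omitD(2)[OF om] by blast
        with K_Plain[OF om hd] KI[OF r(2) atoms_Plain(1)[OF r(1)]] NI[OF r(3), of "{}"] a
        show False by (auto simp: M_def)
      next
        assume "Choice a (pos_body r - A) (neg_body r - A) \<in> omit P A"
        from no_choice[OF a this r(2,3) atoms_Plain(1)[OF r(1)]] show False .
      qed
    qed
    have Choice_M: "Orig a \<notin> M"
      if c: "Choice a Bp Bn \<in> P" "Orig ` Bp \<subseteq> J - M" "Orig ` Bn \<inter> J = {}" for a Bp Bn
      using no_choice[OF _ omit_Choice[OF c(1)] c(2,3) atoms_Choice[OF c(1)]] M_notin_A by blast
    \<comment> \<open>Auxiliary atoms of \<open>J\<close> survive in \<open>J - M\<close>, which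
      settles the dual rule of every choice.\<close>
    have Aux_M: "Aux a \<notin> M" for a by (auto simp: M_def)
    \<comment> \<open>A body true in \<open>J - M\<close> is true in \<open>J\<close>, so
      \<open>J\<close> already supplies the head. The head could be lost only by lying in
      \<open>M\<close>, against \<open>Plain_M\<close>, \<open>Choice_M\<close> and
      \<open>Aux_M\<close>.\<close>
    have "is_model (J - M) (reduct (expand P) J)"
      unfolding is_model_reduct_expand_iff[OF psubset_imp_subset[OF less]]
    proof (intro conjI allI impI)
      fix r assume r: "Plain r \<in> P" "Orig ` pos_body r \<subseteq> J - M" "Orig ` neg_body r \<inter> J = {}"
      then have "Orig ` pos_body r \<subseteq> J" by blast
      with J_Plain[OF r(1) _ r(3)] Plain_M[OF r] show "\<exists>a. head r = Some a \<and> Orig a \<in> J - M"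
        by blast
    next
      fix a Bp Bn
      assume c: "Choice a Bp Bn \<in> P" "Orig ` Bp \<subseteq> J - M" "Orig ` Bn \<inter> J = {}"
      then have "Orig ` Bp \<subseteq> J" by blast
      note J_Choice[OF c(1) this c(3)]
      then show "Aux a \<notin> J \<Longrightarrow> Orig a \<in> J - M" "Orig a \<notin> J \<Longrightarrow> Aux a \<in> J - M"
        using Choice_M[OF c] Aux_M by blast+
    qed
    with min[OF less] show False by blast
  qed
  ultimately have "is_answer_set J' (expand (omit P A))"
    unfolding is_answer_set_def by blast
  moreover have "I' = {a. Orig a \<in> J'}" by (simp add: Orig_J')
  ultimately show ?thesis unfolding AS_def I'_def[symmetric] by blast
qed

end
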